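(* Let $\mathcal{G}$ be a Stackelberg game and $\mathcal{H} \subseteq [K]^{\mathcal{Z}}$ a hypothesis class. Let $A$ be any learning algorithm and $\epsilon, \delta, \gamma \in (0,1)$ such that $\delta < \epsilon$. Then $$m_A(\mathcal{H}, \mathcal{G}; \epsilon, \delta, \gamma) \ge \Omega\left( \frac{\mathrm{SNdim}^{(\gamma)}_{\mathcal{G}}(\mathcal{H}) + \log(1/\delta)}{\epsilon} \right).$$
   Context: Stackelberg game. A (contextual) Stackelberg game is a tuple $\mathcal{G} = (\mathcal{A}, \mathcal{A}_f, \mathcal{Z}, u, u_{f^{(1)}}, \ldots, u_{f^{(K)}})$, where $\mathcal{A}$ and $\mathcal{A}_f$ are the finite action sets of the leader and the follower, $\mathcal{Z} \subseteq \mathbb{R}^d$ is the set of contexts, $u : \mathcal{Z} \times \mathcal{A} \times \mathcal{A}_f \to [0,1]$ is the leader's utility, and $u_{f^{(i)}} : \mathcal{Z} \times \mathcal{A} \times \mathcal{A}_f \to [0,1]$ is the utility of a follower of type $f^{(i)}$, $i \in [K] = \{1,\ldots,K\}$. $\Delta(\mathcal{A})$ is the probability simplex over $\mathcal{A}$ (leader mixed strategies), and $u(\mathbf{z}, \mathbf{x}, a_f) := \sum_{a_l \in \mathcal{A}} \mathbf{x}[a_l]\, u(\mathbf{z}, a_l, a_f)$ for $\mathbf{x} \in \Delta(\mathcal{A})$. The best response of type $f^{(i)}$ is $b_{f^{(i)}}(\mathbf{z}, \mathbf{x}) \in \arg\max_{a_f \in \mathcal{A}_f} \sum_{a_l \in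 \mathcal{A}} \mathbf{x}[a_l]\, u_{f^{(i)}}(\mathbf{z}, a_l, a_f)$, ties being broken by a fixed, known, deterministic order on $\mathcal{A}_f$. The leader's loss is $r(\mathbf{z}, \mathbf{x}, f^{(i)}) := \sup_{\mathbf{x}' \in \Delta(\mathcal{A})} u(\mathbf{z}, \mathbf{x}', b_{f^{(i)}}(\mathbf{z}, \mathbf{x}')) - u(\mathbf{z}, \mathbf{x}, b_{f^{(i)}}(\mathbf{z}, \mathbf{x}))$. Learning algorithm. A mapping $A : (\mathcal{Z} \times [K])^* \to \Delta(\mathcal{A})^{\mathcal{Z}}$; $A(\mathbf{z}; S)$ denotes the strategy played at context $\mathbf{z}$ after training on the sample $S$. PAC cut-off sample complexity. $m_A(\mathcal{H}, \mathcal{G}; \epsilon, \delta, \gamma)$ is the smallest integer such that for any $m \ge m_A(\mathcal{H}, \mathcal{G}; \epsilon, \delta, \gamma)$, every distribution $\mathcal{D}$ on $\mathcal{Z}$ and any target hypothesis $h^* \in \mathcal{H}$, with probability at least $1-\delta$ over the sample $S = \{(\mathbf{z}_i, h^*(\mathbf{z}_i))\}_{i \in [m]}$ with $\mathbf{z}_i \sim \mathcal{D}$ i.i.d., the expected cut-off loss $\mathbb{P}_{\mathbf{z} \sim \mathcal{D}}[ r(\mathbf{z}, A(\mathbf{z}; S), f^{(h^*(\mathbf{z}))}) > \gamma ]$ is at most $\epsilon$ (it is $\infty$ if no such integer exists). $\gamma$-SN-shattering. A set $\{\mathbf{z}_1, \ldots, \mathbf{z}_n\} \subseteq \mathcal{Z}$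 is $\gamma$-SN-shattered by $\mathcal{H}$ with respect to $\mathcal{G}$ if there exist functions $g_0, g_1 : \mathcal{Z} \to [K]$ such that (1) $\inf_{\mathbf{x} \in \Delta(\mathcal{A})} \max_{j \in \{g_0(\mathbf{z}_i), g_1(\mathbf{z}_i)\}} r(\mathbf{z}_i, \mathbf{x}, f^{(j)}) > \gamma$ for every $i \in [n]$, and (2) for all $b \in \{0,1\}^n$ there exists $h_b \in \mathcal{H}$ with $h_b(\mathbf{z}_i) = g_0(\mathbf{z}_i)$ if $b_i = 0$ and $h_b(\mathbf{z}_i) = g_1(\mathbf{z}_i)$ if $b_i = 1$. $\mathrm{SNdim}^{(\gamma)}_{\mathcal{G}}(\mathcal{H})$ (the $\gamma$-valued Stackelberg-Natarajan dimension) is the cardinality of the largest set that is $\gamma$-SN-shattered by $\mathcal{H}$ with respect to $\mathcal{G}$ ($\infty$ if there are arbitrarily large such sets).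
   Formalization: The bound is proved for SNdim ≥ 2 and ε ≤ ε₀, for any fixed ε₀ < 1/2, with the constant in Ω depending only on ε₀; for SNdim ≤ 1, or for ε > 1/2 with SNdim unbounded, no uniform constant exists. *)

theory Defs
  imports "HOL-Probability.Probability"
begin

text \<open>
  Contexts are points of \<open>\<real>\<^sup>d\<close>, represented as in the library's finite product measures: functions
  on the indices below \<open>d\<close>, with a fixed junk value elsewhere.  In this way \<open>d\<close> is a number rather
  than a type, and the constant of a lower bound can be chosen uniformly in it.
\<close>

type_synonym point = "nat \<Rightarrow> real"

record ('a, 'b) game =
  leader_acts :: "'a set"
  follower_acts :: "'b set"
  tie_order :: "'b rel"
  ctx_dim :: nat
  contexts :: "point set"
  num_types :: nat
  leader_util :: "point \<Rightarrow> 'a \<Rightarrow> 'b \<Rightarrow> real"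
  follower_util :: "nat \<Rightarrow> point \<Rightarrow> 'a \<Rightarrow> 'b \<Rightarrow> real"

abbreviation euclidean :: "nat \<Rightarrow> point measure" where
  "euclidean d \<equiv> \<Pi>\<^sub>M i\<in>{..<d}. borel"

abbreviation types :: "('a, 'b) game \<Rightarrow> nat set" where
  "types G \<equiv> {1..num_types G}"

definition stackelberg_game :: "('a, 'b) game \<Rightarrow> bool" where
  "stackelberg_game G \<longleftrightarrow>
     finite (leader_acts G) \<and> leader_acts G \<noteq> {} \<and>
     finite (follower_acts G) \<and> follower_acts G \<noteq> {} \<and>
     linear_order_on (follower_acts G) (tie_order G) \<and>
     contexts G \<subseteq> space (euclidean (ctx_dim G)) \<and>
     (\<forall>z\<in>contexts G. \<forall>a\<in>leader_acts G. \<forall>b\<in>follower_acts G.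
        leader_util G z a b \<in> {0..1} \<and>
        (\<forall>i\<in>types G. follower_util G i z a b \<in> {0..1}))"

definition mixed :: "('a, 'b) game \<Rightarrow> 'a pmf set" where
  "mixed G = {x. set_pmf x \<subseteq> leader_acts G}"

definition leader_payoff :: "('a, 'b) game \<Rightarrow> point \<Rightarrow> 'a pmf \<Rightarrow> 'b \<Rightarrow> real" where
  "leader_payoff G z x b = (\<Sum>a\<in>leader_acts G. pmf x a * leader_util G z a b)"

definition follower_payoff :: "('a, 'b) game \<Rightarrow> nat \<Rightarrow> point \<Rightarrow> 'a pmf \<Rightarrow> 'b \<Rightarrow> real" where
  "follower_payoff G i z x b = (\<Sum>a\<in>leader_acts G. pmf x a * follower_util G i z a b)"

definition best_responses :: "('a, 'b) game \<Rightarrow> nat \<Rightarrow> point \<Rightarrow> 'a pmf \<Rightarrow> 'b set" where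
  "best_responses G i z x =
     {b. is_arg_max (follower_payoff G i z x) (\<lambda>b. b \<in> follower_acts G) b}"

text \<open>Among the maximisers the follower plays the first one in the tie-breaking order.\<close>

definition best_response :: "('a, 'b) game \<Rightarrow> nat \<Rightarrow> point \<Rightarrow> 'a pmf \<Rightarrow> 'b" where
  "best_response G i z x =
     (THE b. b \<in> best_responses G i z x \<and>
        (\<forall>b'\<in>best_responses G i z x. (b, b') \<in> tie_order G))"

definition loss :: "('a, 'b) game \<Rightarrow> point \<Rightarrow> 'a pmf \<Rightarrow> nat \<Rightarrow> real" where
  "loss G z x i =
     (SUP x'\<in>mixed G. leader_payoff G z x' (best_response G i z x'))
       - leader_payoff G z x (best_response G i z x)"

type_synonym 'a learner = "(point \<times> nat) list \<Rightarrow> point \<Rightarrow> 'a pmf"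

definition learning_algorithm :: "('a, 'b) game \<Rightarrow> 'a learner \<Rightarrow> bool" where
  "learning_algorithm G A \<longleftrightarrow>
     (\<forall>S z. set S \<subseteq> contexts G \<times> types G \<longrightarrow> z \<in> contexts G \<longrightarrow> A S z \<in> mixed G)"

definition distributions :: "('a, 'b) game \<Rightarrow> point measure set" where
  "distributions G =
     {D. prob_space D \<and>
         sets D = sets (restrict_space (euclidean (ctx_dim G)) (contexts G))}"

definition sample :: "nat \<Rightarrow> (point \<Rightarrow> nat) \<Rightarrow> (nat \<Rightarrow> point) \<Rightarrow> (point \<times> nat) list" where
  "sample m h zs = map (\<lambda>i. (zs i, h (zs i))) [0..<m]"

text \<open>
  Utilities, hypotheses and the learner are arbitrary functions, so the events below need not be
  measurable.  The probability of the cut-off event is therefore an outer measure, and an event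
  has probability at least \<open>1 - \<delta>\<close> if it contains a measurable event of such probability; for
  measurable events these are the usual notions.
\<close>

definition cutoff_loss ::
    "('a, 'b) game \<Rightarrow> point measure \<Rightarrow> (point \<Rightarrow> nat) \<Rightarrow> real \<Rightarrow> (point \<Rightarrow> 'a pmf) \<Rightarrow> ennreal" where
  "cutoff_loss G D h \<gamma> f = outer_measure_of D {z \<in> contexts G. loss G z (f z) (h z) > \<gamma>}"

definition pac_at ::
    "('a, 'b) game \<Rightarrow> (point \<Rightarrow> nat) set \<Rightarrow> 'a learner \<Rightarrow> real \<Rightarrow> real \<Rightarrow> real \<Rightarrow> nat \<Rightarrow> bool" where
  "pac_at G H A \<epsilon> \<delta> \<gamma> m \<longleftrightarrow>
     (\<forall>D\<in>distributions G. \<forall>h\<in>H.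
        \<exists>E\<in>sets (\<Pi>\<^sub>M i\<in>{..<m}. D).
          measure (\<Pi>\<^sub>M i\<in>{..<m}. D) E \<ge> 1 - \<delta> \<and>
          (\<forall>zs\<in>E. cutoff_loss G D h \<gamma> (A (sample m h zs)) \<le> ennreal \<epsilon>))"

definition sample_complexity ::
    "('a, 'b) game \<Rightarrow> (point \<Rightarrow> nat) set \<Rightarrow> 'a learner \<Rightarrow> real \<Rightarrow> real \<Rightarrow> real \<Rightarrow> enat" where
  "sample_complexity G H A \<epsilon> \<delta> \<gamma> = (INF M\<in>{M. \<forall>m\<ge>M. pac_at G H A \<epsilon> \<delta> \<gamma> m}. enat M)"

definition SN_shattered ::
    "('a, 'b) game \<Rightarrow> (point \<Rightarrow> nat) set \<Rightarrow> real \<Rightarrow> point set \<Rightarrow> bool" where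
  "SN_shattered G H \<gamma> W \<longleftrightarrow>
     finite W \<and> W \<subseteq> contexts G \<and>
     (\<exists>g\<^sub>0 \<in> contexts G \<rightarrow> types G. \<exists>g\<^sub>1 \<in> contexts G \<rightarrow> types G.
        (\<forall>z\<in>W. (INF x\<in>mixed G. max (loss G z x (g\<^sub>0 z)) (loss G z x (g\<^sub>1 z))) > \<gamma>) \<and>
        (\<forall>b :: point \<Rightarrow> bool. \<exists>h\<in>H. \<forall>z\<in>W. h z = (if b z then g\<^sub>1 z else g\<^sub>0 z)))"

definition SNdim :: "('a, 'b) game \<Rightarrow> (point \<Rightarrow> nat) set \<Rightarrow> real \<Rightarrow> enat" where
  "SNdim G H \<gamma> = (SUP W\<in>{W. SN_shattered G H \<gamma> W}. enat (card W))"

end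

theory Submission
  imports Defs
begin

text \<open>
  On a shattered set of \<open>d\<close> points, put mass \<open>1 - p\<close> on one point and spread \<open>p\<close> evenly over the
  others, with \<open>p = 2\<epsilon> / (1/2 + \<epsilon>\<^sub>0)\<close>.  If fewer than \<open>(1/2 - \<epsilon>\<^sub>0)(d - 1)\<close> samples are light, the
  unseen mass exceeds \<open>2\<epsilon>\<close>, and then for every target, either it or its flip on the unseen points
  defeats the learner; averaging over all targets, this has probability at most \<open>2\<delta>\<close>.  Markov's
  inequality turns this into \<open>m = \<Omega>(d / \<epsilon>)\<close>, and the event that no sample is light, of probability
  \<open>(1 - p)\<^sup>m\<close>, into \<open>m = \<Omega>(ln (1 / 2\<delta>) / \<epsilon>)\<close>.
\<close>

section \<open>Best responses and bounds on the loss\<close>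

lemma finite_linear_order_least:
  assumes "finite S" "S \<noteq> {}" "S \<subseteq> B" "linear_order_on B r"
  shows "\<exists>!b. b \<in> S \<and> (\<forall>b'\<in>S. (b, b') \<in> r)"
proof -
  have r: "refl_on B r" "trans r" "antisym r" "total_on B r"
    using assms(4) by (auto simp: order_on_defs)
  have "\<exists>b\<in>S. \<forall>b'\<in>S. (b, b') \<in> r"
    using assms(1-3)
  proof (induction S rule: finite_ne_induct)
    case (singleton x)
    then show ?case using r(1) by (auto simp: refl_on_def)
  next
    case (insert x F)
    then obtain b where b: "b \<in> F" "\<forall>b'\<in>F. (b, b') \<in> r" by auto
    have "(x, b) \<in> r \<or> (b, x) \<in> r"
      using r(4) insert b unfolding total_on_def by (metis insert_subset subsetD)
    moreover have "(x, x) \<in> r"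
      using r(1) insert.prems by (auto simp: refl_on_def)
    ultimately show ?case
      using b transD[OF r(2)] by (metis insert_iff)
  qed
  then show ?thesis
    using antisymD[OF r(3)] by blast
qed

text \<open>A finite nonempty set of maximisers has exactly one least element in the tie order, so
  the definite description in \<open>best_response\<close> denotes an actual action.\<close>

lemma best_response_in_follower_acts:
  assumes "stackelberg_game G"
  shows "best_response G i z x \<in> follower_acts G"
proof -
  let ?S = "best_responses G i z x"
  have fin: "finite (follower_acts G)" "follower_acts G \<noteq> {}"
    and ord: "linear_order_on (follower_acts G) (tie_order G)"
    using assms by (auto simp: stackelberg_game_def)
  have sub: "?S \<subseteq> follower_acts G"
    by (auto simp: best_responses_def is_arg_max_def)
  have "Max (follower_payoff G i z x ` follower_acts G) \<in> follower_payoff G i z x ` follower_acts G"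
    using fin by (intro Max_in) auto
  then obtain b where b: "b \<in> follower_acts G"
    "follower_payoff G i z x b = Max (follower_payoff G i z x ` follower_acts G)"
    by auto
  have "b \<in> ?S"
    using b fin by (auto simp: best_responses_def is_arg_max_linorder)
  then have "\<exists>!b. b \<in> ?S \<and> (\<forall>b'\<in>?S. (b, b') \<in> tie_order G)"
    using finite_linear_order_least[OF finite_subset[OF sub fin(1)] _ sub ord] by blast
  from theI'[OF this] show ?thesis
    using sub by (auto simp: best_response_def)
qed

lemma leader_payoff_le_1:
  assumes "stackelberg_game G" "z \<in> contexts G" "x \<in> mixed G" "b \<in> follower_acts G"
  shows "leader_payoff G z x b \<le> 1"
proof -
  have "leader_payoff G z x b \<le> (\<Sum>a\<in>leader_acts G. pmf x a * 1)"
    unfolding leader_payoff_def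
    using assms by (intro sum_mono mult_left_mono) (auto simp: stackelberg_game_def)
  also have "\<dots> = 1"
    using assms by (auto simp: stackelberg_game_def mixed_def intro!: sum_pmf_eq_1)
  finally show ?thesis .
qed

text \<open>A real infimum bounds the members from below only when the set is bounded below. Leader
  payoffs are at most 1, so every loss against type \<open>i\<close> is at least \<open>?C\<close>,
  which does not depend on \<open>x\<close>.\<close>

lemma inf_max_loss_gt:
  assumes "stackelberg_game G" "z \<in> contexts G" "x \<in> mixed G"
    and "(INF x\<in>mixed G. max (loss G z x i) (loss G z x j)) > \<gamma>"
  shows "loss G z x i > \<gamma> \<or> loss G z x j > \<gamma>"
proof -
  let ?C = "(SUP x'\<in>mixed G. leader_payoff G z x' (best_response G i z x')) - 1"
  have "?C \<le> max (loss G z x i) (loss G z x j)" if "x \<in> mixed G" for x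
    using leader_payoff_le_1[OF assms(1,2) that best_response_in_follower_acts[OF assms(1), of i z x]]
    by (auto simp: loss_def le_max_iff_disj)
  then have "bdd_below ((\<lambda>x. max (loss G z x i) (loss G z x j)) ` mixed G)"
    by (intro bdd_belowI2[where m = ?C])
  from cINF_lower[OF this assms(3)] assms(4) show ?thesis
    by (auto simp: less_max_iff_disj)
qed

section \<open>Finite events, a double-counting bound, finitely supported distributions\<close>

text \<open>Contexts are extensional, so a singleton is a finite box of real singletons. It is
  measurable in the trace even if \<open>X\<close> itself is not measurable.\<close>

lemma singleton_in_sets_contexts:
  assumes "z \<in> X" "X \<subseteq> space (euclidean n)"
  shows "{z} \<in> sets (restrict_space (euclidean n) X)"
proof -
  have "{z} = (\<Pi>\<^sub>E i\<in>{..<n}. {z i})"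
    using assms by (intro PiE_singleton[symmetric]) (auto simp: space_PiM PiE_def)
  also have "\<dots> \<in> sets (euclidean n)"
    by (intro sets_PiM_I_finite) auto
  finally have "{z} \<in> sets (euclidean n)" .
  moreover have "{z} = X \<inter> {z}" using assms by auto
  ultimately show ?thesis
    unfolding sets_restrict_space by (rule rev_image_eqI)
qed

text \<open>For fixed \<open>x\<close> in \<open>B\<close>, the injection \<open>f x\<close> sends
  each index whose event contains \<open>x\<close> to one whose event does not, so \<open>x\<close>
  lies in at most half of the events. Integrating over \<open>B\<close>, the events meet
  \<open>B\<close> in at most half its probability on average, yet each meets it in all but
  \<delta>.\<close>

lemma prob_le_of_pairing:
  fixes E :: "'k \<Rightarrow> 'b set" and f :: "'b \<Rightarrow> 'k \<Rightarrow> 'k"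
  assumes "prob_space M" "finite K" "K \<noteq> {}" "B \<in> sets M"
    and E: "\<And>k. k \<in> K \<Longrightarrow> E k \<in> sets M" "\<And>k. k \<in> K \<Longrightarrow> measure M (E k) \<ge> 1 - \<delta>"
    and f: "\<And>x. x \<in> B \<Longrightarrow> f x ` K \<subseteq> K" "\<And>x. x \<in> B \<Longrightarrow> inj_on (f x) K"
    and disj: "\<And>x k. x \<in> B \<Longrightarrow> k \<in> K \<Longrightarrow> x \<in> E k \<Longrightarrow> x \<notin> E (f x k)"
  shows "measure M B \<le> 2 * \<delta>"
proof -
  interpret prob_space M by fact
  have card: "2 * card {k\<in>K. x \<in> E k} \<le> card K" if x: "x \<in> B" for x
  proof -
    let ?S = "{k\<in>K. x \<in> E k}"
    have "card ?S + card (f x ` ?S) = card (?S \<union> f x ` ?S)"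
      using disj[OF x] \<open>finite K\<close> by (intro card_Un_disjoint[symmetric]) auto
    also have "\<dots> \<le> card K"
      using f(1)[OF x] \<open>finite K\<close> by (intro card_mono) auto
    also have "card (f x ` ?S) = card ?S"
      using f(2)[OF x] by (intro card_image) (auto intro: inj_on_subset)
    finally show ?thesis by simp
  qed
  have "card K * (prob B - \<delta>) = (\<Sum>k\<in>K. prob B - \<delta>)" by simp
  also have "\<dots> \<le> (\<Sum>k\<in>K. prob (E k \<inter> B))"
  proof (intro sum_mono)
    fix k assume k: "k \<in> K"
    have "prob B \<le> prob ((E k \<inter> B) \<union> (space M - E k))"
      using k E(1) assms(4) sets.sets_into_space[OF assms(4)] by (intro finite_measure_mono) auto
    also have "\<dots> \<le> prob (E k \<inter> B) + prob (space M - E k)"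
      using k E(1) assms(4) by (intro measure_Un_le) auto
    also have "\<dots> \<le> prob (E k \<inter> B) + \<delta>"
      using E(2)[OF k] prob_compl[OF E(1)[OF k]] by simp
    finally show "prob B - \<delta> \<le> prob (E k \<inter> B)" by simp
  qed
  also have "\<dots> = (\<Sum>k\<in>K. \<integral>x. indicator (E k \<inter> B) x \<partial>M)"
    using E(1) assms(4) by (intro sum.cong) auto
  also have "\<dots> = (\<integral>x. (\<Sum>k\<in>K. indicator (E k \<inter> B) x) \<partial>M)"
    using E(1) assms(4) by (intro Bochner_Integration.integral_sum[symmetric])
      (auto simp: integrable_indicator_iff emeasure_eq_measure)
  also have "\<dots> \<le> (\<integral>x. card K / 2 * indicator B x \<partial>M)"
  proof (intro integral_mono)
    fix x
    have "(\<Sum>k\<in>K. indicator (E k \<inter> B) x) = real (card {k\<in>K. x \<in> E k}) * indicator B x"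
      using \<open>finite K\<close> by (auto simp: indicator_def sum.If_cases Int_def)
    also have "\<dots> \<le> card K / 2 * indicator B x"
      using card[of x] by (auto simp: indicator_def)
    finally show "(\<Sum>k\<in>K. indicator (E k \<inter> B) x) \<le> card K / 2 * indicator B x" .
  qed (use E(1) assms(4) in \<open>auto simp: integrable_indicator_iff emeasure_eq_measure\<close>)
  also have "\<dots> = card K / 2 * prob B"
    using assms(4) by simp
  finally have "real (card K) * (prob B - \<delta> - prob B / 2) \<le> 0"
    by (simp add: algebra_simps)
  moreover have "card K > 0" using assms(2,3) by (simp add: card_gt_0_iff)
  ultimately show ?thesis by (simp add: mult_le_0_iff)
qed

text \<open>The point measure lives on the power set of \<open>W\<close>; pushing it forward along
  the identity moves it to the trace sigma-algebra that \<open>distributions\<close>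
  demands.\<close>

lemma distribution_of_weights:
  assumes "finite W" "W \<subseteq> contexts G" "contexts G \<subseteq> space (euclidean (ctx_dim G))"
    and "\<And>z. z \<in> W \<Longrightarrow> w z \<ge> 0" "(\<Sum>z\<in>W. w z) = 1"
  obtains D where "D \<in> distributions G" "\<And>S. S \<subseteq> W \<Longrightarrow> S \<in> sets D"
    "\<And>S. S \<subseteq> W \<Longrightarrow> measure D S = (\<Sum>z\<in>S. w z)"
proof
  let ?R = "restrict_space (euclidean (ctx_dim G)) (contexts G)"
  let ?P = "point_measure W (\<lambda>z. ennreal (w z))"
  define D where "D = distr ?P ?R (\<lambda>z. z)"
  have meas: "(\<lambda>z. z) \<in> measurable ?P ?R"
    using assms by (auto simp: measurable_def space_point_measure space_restrict_space sets_point_measure)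
  have "emeasure ?P W = (\<Sum>z\<in>W. ennreal (w z))"
    using assms(1) by (intro emeasure_point_measure_finite) auto
  also have "\<dots> = 1"
    using assms(4,5) by (simp add: sum_ennreal)
  finally have "prob_space ?P"
    by (intro prob_spaceI) (simp add: space_point_measure)
  then show "D \<in> distributions G"
    unfolding distributions_def D_def using prob_space.prob_space_distr[OF _ meas] by auto
  show sets: "S \<in> sets D" if "S \<subseteq> W" for S
  proof -
    have "(\<Union>z\<in>S. {z}) \<in> sets ?R"
      using that assms
      by (intro sets.finite_UN finite_subset[OF that] singleton_in_sets_contexts) auto
    then show ?thesis by (simp add: D_def)
  qed
  show "measure D S = (\<Sum>z\<in>S. w z)" if "S \<subseteq> W" for S
  proof -
    have "emeasure D S = emeasure ?P ((\<lambda>z. z) -` S \<inter> space ?P)"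
      unfolding D_def using meas sets[OF that] by (intro emeasure_distr) (auto simp: D_def)
    also have "(\<lambda>z. z) -` S \<inter> space ?P = S"
      using that by (auto simp: space_point_measure)
    also have "emeasure ?P S = (\<Sum>z\<in>S. ennreal (w z))"
      using assms(1) that by (intro emeasure_point_measure_finite)
    also have "\<dots> = ennreal (\<Sum>z\<in>S. w z)"
      using that assms(4) by (intro sum_ennreal) auto
    finally show ?thesis
      using that assms(4) by (intro measure_eq_emeasure_eq_ennreal) (auto intro: sum_nonneg)
  qed
qed

text \<open>Such a set is a finite union of singleton boxes; this settles measurability for every
  event of tuples from \<open>W\<close> at once.\<close>

lemma PiE_subset_in_sets_PiM:
  assumes "finite I" "finite W" "\<And>z. z \<in> W \<Longrightarrow> {z} \<in> sets D" "B \<subseteq> (\<Pi>\<^sub>E i\<in>I. W)"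
  shows "B \<in> sets (\<Pi>\<^sub>M i\<in>I. D)"
proof -
  have "{zs} \<in> sets (\<Pi>\<^sub>M i\<in>I. D)" if "zs \<in> B" for zs
  proof -
    have "zs \<in> (\<Pi>\<^sub>E i\<in>I. W)" using that assms(4) by auto
    then have "{zs} = (\<Pi>\<^sub>E i\<in>I. {zs i})"
      by (intro PiE_singleton[symmetric]) (auto simp: PiE_def)
    also have "\<dots> \<in> sets (\<Pi>\<^sub>M i\<in>I. D)"
      using \<open>zs \<in> (\<Pi>\<^sub>E i\<in>I. W)\<close> assms(1,3) by (intro sets_PiM_I_finite) (auto dest: PiE_mem)
    finally show ?thesis .
  qed
  moreover have "finite B"
    using assms(1,2,4) by (metis finite_PiE finite_subset)
  ultimately have "(\<Union>zs\<in>B. {zs}) \<in> sets (\<Pi>\<^sub>M i\<in>I. D)"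
    by (intro sets.finite_UN)
  then show ?thesis by simp
qed

section \<open>Flipping the target on the unseen points\<close>

text \<open>
  Flipping the target on the unseen points does not change the sample, and on every unseen point
  the learner exceeds the cut-off for one of the two targets, so the two errors add up to at least
  the unseen mass.
\<close>

lemma prob_large_unseen_mass_le:
  fixes G :: "('a, 'b) game" and A :: "'a learner"
  assumes game: "stackelberg_game G" and H: "H \<subseteq> contexts G \<rightarrow>\<^sub>E types G"
    and A: "learning_algorithm G A" and W: "SN_shattered G H \<gamma> W"
    and D: "D \<in> distributions G" and setsD: "\<And>S. S \<subseteq> W \<Longrightarrow> S \<in> sets D"
    and pac: "pac_at G H A \<epsilon> \<delta> \<gamma> m" and "\<epsilon> \<ge> 0"
    and B: "B \<subseteq> {..<m} \<rightarrow>\<^sub>E W" "\<And>zs. zs \<in> B \<Longrightarrow> measure D (W - zs ` {..<m}) > 2 * \<epsilon>"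
  shows "measure (\<Pi>\<^sub>M i\<in>{..<m}. D) B \<le> 2 * \<delta>"
proof -
  interpret D: prob_space D using D by (auto simp: distributions_def)
  interpret P: product_prob_space "\<lambda>_. D" "{..<m}"
    by unfold_locales
  have finW: "finite W" and WZ: "W \<subseteq> contexts G"
    using W by (auto simp: SN_shattered_def)
  from W obtain g0 g1 where
    sep: "\<And>z. z \<in> W \<Longrightarrow> (INF x\<in>mixed G. max (loss G z x (g0 z)) (loss G z x (g1 z))) > \<gamma>"
    and shat: "\<And>b :: point \<Rightarrow> bool. \<exists>h\<in>H. \<forall>z\<in>W. h z = (if b z then g1 z else g0 z)"
    unfolding SN_shattered_def by blast
  \<comment> \<open>Targets are indexed by sets \<open>X\<close>: the points of \<open>W\<close>
    where the target follows \<open>g1\<close>.\<close>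
  have "\<exists>h\<in>H. \<forall>z\<in>W. h z = (if z \<in> X then g1 z else g0 z)" for X
    using shat[of "\<lambda>z. z \<in> X"] .
  then obtain h where h: "\<And>X. h X \<in> H" "\<And>X z. z \<in> W \<Longrightarrow> h X z = (if z \<in> X then g1 z else g0 z)"
    by metis
  have "\<exists>E. E \<in> sets (\<Pi>\<^sub>M i\<in>{..<m}. D) \<and> measure (\<Pi>\<^sub>M i\<in>{..<m}. D) E \<ge> 1 - \<delta> \<and>
      (\<forall>zs\<in>E. cutoff_loss G D (h X) \<gamma> (A (sample m (h X) zs)) \<le> ennreal \<epsilon>)" for X
    using pac D h(1)[of X] unfolding pac_at_def by blast
  then obtain E where E: "\<And>X. E X \<in> sets (\<Pi>\<^sub>M i\<in>{..<m}. D)"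
      "\<And>X. measure (\<Pi>\<^sub>M i\<in>{..<m}. D) (E X) \<ge> 1 - \<delta>"
      "\<And>X zs. zs \<in> E X \<Longrightarrow> cutoff_loss G D (h X) \<gamma> (A (sample m (h X) zs)) \<le> ennreal \<epsilon>"
    by metis
  \<comment> \<open>Symmetric difference with the unseen points, hence an involution for fixed
    \<open>zs\<close>.\<close>
  define flip where "flip = (\<lambda>zs X. (X - (W - zs ` {..<m})) \<union> ((W - zs ` {..<m}) - X))"
  show ?thesis
  proof (rule prob_le_of_pairing[where K = "Pow W" and E = E and f = flip])
    show "prob_space (\<Pi>\<^sub>M i\<in>{..<m}. D)" by (rule P.prob_space_axioms)
    show "B \<in> sets (\<Pi>\<^sub>M i\<in>{..<m}. D)"
      using finW B(1) setsD by (intro PiE_subset_in_sets_PiM[of _ W]) auto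
    show "inj_on (flip zs) (Pow W)" for zs
    proof (rule inj_onI)
      fix X Y assume "flip zs X = flip zs Y"
      then have "flip zs (flip zs X) = flip zs (flip zs Y)" by simp
      moreover have "flip zs (flip zs X) = X" for X by (auto simp: flip_def)
      ultimately show "X = Y" by simp
    qed
    show "flip zs ` Pow W \<subseteq> Pow W" for zs by (auto simp: flip_def)
    fix zs X assume zs: "zs \<in> B" and X: "X \<in> Pow W" and zsE: "zs \<in> E X"
    show "zs \<notin> E (flip zs X)"
    proof
      assume zsE': "zs \<in> E (flip zs X)"
      let ?U = "W - zs ` {..<m}" and ?Y = "flip zs X"
      have zsW: "zs i \<in> W" if "i < m" for i using zs B(1) that by (auto dest: PiE_mem)
      have "h X (zs i) = h ?Y (zs i)" if "i < m" for i
        using zsW[OF that] that by (auto simp: h(2) flip_def)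
      then have same: "sample m (h ?Y) zs = sample m (h X) zs"
        by (auto simp: sample_def)
      define a where "a = A (sample m (h X) zs)"
      \<comment> \<open>A learner is constrained only on well-typed samples, so the labels must be
        types before its outputs are known to be mixed strategies.\<close>
      have "h X \<in> contexts G \<rightarrow>\<^sub>E types G" using H h(1) by auto
      then have "set (sample m (h X) zs) \<subseteq> contexts G \<times> types G"
        using zsW WZ by (fastforce simp: sample_def dest: PiE_mem)
      then have mix: "a z \<in> mixed G" if "z \<in> W" for z
        using A that WZ unfolding learning_algorithm_def a_def by blast
      \<comment> \<open>The trace on \<open>W\<close> of the error event is measurable, and the
        outer measure in \<open>cutoff_loss\<close> dominates its measure.\<close>
      define T where "T = (\<lambda>X. {z\<in>W. loss G z (a z) (h X z) > \<gamma>})"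
      have small: "measure D (T X') \<le> \<epsilon>" if "cutoff_loss G D (h X') \<gamma> a \<le> ennreal \<epsilon>" for X'
      proof -
        have "T X' \<in> sets D" by (intro setsD) (auto simp: T_def)
        then have "emeasure D (T X') = outer_measure_of D (T X')"
          by (simp add: outer_measure_of_eq)
        also have "\<dots> \<le> outer_measure_of D {z \<in> contexts G. loss G z (a z) (h X' z) > \<gamma>}"
          using WZ by (intro outer_measure_of_mono) (auto simp: T_def)
        also have "\<dots> \<le> ennreal \<epsilon>" using that by (simp add: cutoff_loss_def)
        finally show ?thesis using \<open>\<epsilon> \<ge> 0\<close> by (simp add: D.emeasure_eq_measure)
      qed
      have "?U \<subseteq> T X \<union> T ?Y"
      proof
        fix z assume z: "z \<in> ?U"
        then have "loss G z (a z) (g0 z) > \<gamma> \<or> loss G z (a z) (g1 z) > \<gamma>"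
          using inf_max_loss_gt[OF game _ mix sep] WZ by auto
        \<comment> \<open>An unseen \<open>z\<close> lies in exactly one of \<open>X\<close> and
          \<open>?Y\<close>, so the two targets take both values \<open>g0 z\<close> and
          \<open>g1 z\<close> there.\<close>
        then show "z \<in> T X \<union> T ?Y"
          using z by (auto simp: T_def h(2) flip_def)
      qed
      then have "measure D ?U \<le> measure D (T X \<union> T ?Y)"
        by (intro D.finite_measure_mono setsD) (auto simp: T_def)
      also have "\<dots> \<le> measure D (T X) + measure D (T ?Y)"
        by (intro measure_Un_le setsD) (auto simp: T_def)
      also have "\<dots> \<le> \<epsilon> + \<epsilon>"
        using E(3)[OF zsE] E(3)[OF zsE'] unfolding same a_def[symmetric]
        by (intro add_mono small)
      finally show False using B(2)[OF zs] by simp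
    qed
  qed (use finW E in auto)
qed

section \<open>Samples that mostly hit the heavy point\<close>

text \<open>The number of draws off \<open>z\<^sub>0\<close> has mean \<open>m * p\<close>, so
  Markov's inequality gives the first bound. The tuple constantly \<open>z\<^sub>0\<close> lies in
  \<open>B\<close> because \<open>t > 0\<close>, which gives the second.\<close>

lemma prob_few_outside_ge:
  fixes t :: real and m :: nat
  assumes "prob_space D" "finite W" "z\<^sub>0 \<in> W" "\<And>S. S \<subseteq> W \<Longrightarrow> S \<in> sets D"
    and W: "measure D W = 1" and p: "measure D {z\<^sub>0} = 1 - p" and "t > 0"
  defines "B \<equiv> {zs \<in> {..<m} \<rightarrow>\<^sub>E W. real (card {i\<in>{..<m}. zs i \<noteq> z\<^sub>0}) < t}"
  shows "measure (\<Pi>\<^sub>M i\<in>{..<m}. D) B \<ge> 1 - real m * p / t"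
    and "measure (\<Pi>\<^sub>M i\<in>{..<m}. D) B \<ge> (1 - p) ^ m"
proof -
  interpret D: prob_space D by fact
  let ?M = "\<Pi>\<^sub>M i\<in>{..<m}. D"
  interpret P: finite_product_prob_space "\<lambda>_. D" "{..<m}"
    by unfold_locales auto
  have Bsets: "B \<in> sets ?M"
    using assms(2,4) by (intro PiE_subset_in_sets_PiM[of _ W]) (auto simp: B_def)
  have z0: "{z\<^sub>0} \<in> sets D" and Ws: "W \<in> sets D" using assms(3,4) by auto
  have box: "measure ?M ({..<m} \<rightarrow>\<^sub>E S) = measure D S ^ m" if "S \<in> sets D" for S
    using P.prob_times[of "\<lambda>_. S"] that by simp
  have "(1 - p) ^ m = measure ?M ({..<m} \<rightarrow>\<^sub>E {z\<^sub>0})"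
    using box[OF z0] p by simp
  also have "\<dots> \<le> measure ?M B"
  proof (intro P.finite_measure_mono Bsets subsetI)
    fix zs assume zs: "zs \<in> {..<m} \<rightarrow>\<^sub>E {z\<^sub>0}"
    then have "{i\<in>{..<m}. zs i \<noteq> z\<^sub>0} = {}" by (auto dest: PiE_mem)
    then have "real (card {i\<in>{..<m}. zs i \<noteq> z\<^sub>0}) < t"
      using \<open>t > 0\<close> by (simp only: card.empty of_nat_0)
    moreover have "zs \<in> {..<m} \<rightarrow>\<^sub>E W"
      using zs assms(3) by (auto simp: PiE_iff)
    ultimately show "zs \<in> B" by (simp add: B_def)
  qed
  finally show "measure ?M B \<ge> (1 - p) ^ m" .
  define F where "F = (\<lambda>i. {zs \<in> space ?M. zs i \<in> space D - {z\<^sub>0}})"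
  have Fs: "F i \<in> sets ?M" if "i < m" for i
  proof -
    have "(\<lambda>zs. zs i) -` (space D - {z\<^sub>0}) \<inter> space ?M \<in> sets ?M"
      using that z0 by (intro measurable_sets[OF measurable_component_singleton]) auto
    moreover have "F i = (\<lambda>zs. zs i) -` (space D - {z\<^sub>0}) \<inter> space ?M"
      by (auto simp: F_def)
    ultimately show ?thesis by simp
  qed
  have Fp: "measure ?M (F i) = p" if "i < m" for i
  proof -
    have "measure ?M (F i) = measure (distr ?M D (\<lambda>zs. zs i)) (space D - {z\<^sub>0})"
      using z0 that by (subst measure_distr) (auto simp: F_def intro!: arg_cong[where f = "measure ?M"])
    also have "distr ?M D (\<lambda>zs. zs i) = D"
      using that by (intro distr_PiM_component) (auto intro: D.prob_space_axioms)
    finally show ?thesis using D.prob_compl[OF z0] p by simp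
  qed
  let ?N = "\<lambda>zs. \<Sum>i<m. indicator (F i) zs :: real"
  have N: "?N zs = real (card {i\<in>{..<m}. zs i \<noteq> z\<^sub>0})" if "zs \<in> space ?M" for zs
  proof -
    have "?N zs = (\<Sum>i<m. if zs i \<noteq> z\<^sub>0 then 1 else 0)"
      using that by (intro sum.cong) (auto simp: F_def indicator_def space_PiM dest: PiE_mem)
    then show ?thesis by (simp add: sum.If_cases Int_def)
  qed
  have int: "integrable ?M ?N"
    using Fs by (auto simp: integrable_indicator_iff P.emeasure_eq_measure)
  have EN: "(\<integral>zs. ?N zs \<partial>?M) = real m * p"
    using Fs Fp by (subst Bochner_Integration.integral_sum)
      (auto simp: integrable_indicator_iff P.emeasure_eq_measure)
  let ?L = "{zs \<in> space ?M. ?N zs \<ge> t}"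
  have L: "measure ?M ?L \<le> real m * p / t"
    using integral_Markov_inequality_measure[OF int, of "{}" t] \<open>t > 0\<close> EN by (auto intro: sum_nonneg)
  have Ls: "?L \<in> sets ?M" using int by measurable
  \<comment> \<open>The box over \<open>W\<close> has full measure and is covered by
    \<open>B\<close> and the Markov event \<open>?L\<close>.\<close>
  have "1 = measure ?M ({..<m} \<rightarrow>\<^sub>E W)" using box[OF Ws] W by simp
  also have "\<dots> \<le> measure ?M (B \<union> ?L)"
  proof (intro P.finite_measure_mono sets.Un Bsets Ls subsetI)
    fix zs assume zs: "zs \<in> {..<m} \<rightarrow>\<^sub>E W"
    then have "zs \<in> space ?M"
      using sets.sets_into_space[OF Ws] by (auto simp: space_PiM PiE_iff)
    with zs show "zs \<in> B \<union> ?L" using N by (auto simp: B_def)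
  qed
  also have "\<dots> \<le> measure ?M B + measure ?M ?L"
    by (intro measure_Un_le Bsets Ls)
  finally show "measure ?M B \<ge> 1 - real m * p / t" using L by simp
qed

section \<open>The quantitative bound at one sample size\<close>

text \<open>Two shattered points are the least that leaves a light point beside the heavy one. The
  gap between \<open>\<epsilon>\<^sub>0\<close> and 1/2 serves twice: it keeps mass on the heavy
  point, and it keeps \<open>1 - 2 * \<delta>\<close> away from 0.\<close>

lemma pac_at_lower_bound:
  fixes G :: "('a, 'b) game" and A :: "'a learner"
  assumes game: "stackelberg_game G" and H: "H \<subseteq> contexts G \<rightarrow>\<^sub>E types G"
    and A: "learning_algorithm G A" and W: "SN_shattered G H \<gamma> W" and card: "card W \<ge> 2"
    and pac: "pac_at G H A \<epsilon> \<delta> \<gamma> m"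
    and \<epsilon>: "0 < \<epsilon>" "\<epsilon> \<le> \<epsilon>\<^sub>0" "\<epsilon>\<^sub>0 < 1 / 2" and \<delta>: "0 < \<delta>" "\<delta> < \<epsilon>"
  shows "(1 / 2 - \<epsilon>\<^sub>0)\<^sup>2 / 16 * (card W + ln (1 / \<delta>)) \<le> \<epsilon> * m"
proof -
  define \<kappa> where "\<kappa> = 1 / 2 - \<epsilon>\<^sub>0"
  \<comment> \<open>Chosen so that (1 - \<kappa>) p = 2 \<epsilon>: with fewer than \<kappa> n of
    the \<open>n\<close> light points seen, the unseen light mass exceeds 2 \<epsilon>.\<close>
  define p where "p = 2 * \<epsilon> / (1 - \<kappa>)"
  define n where "n = real (card W) - 1"
  have finW: "finite W" and WZ: "W \<subseteq> contexts G"
    using W by (auto simp: SN_shattered_def)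
  have ctx: "contexts G \<subseteq> space (euclidean (ctx_dim G))"
    using game by (auto simp: stackelberg_game_def)
  have \<kappa>: "0 < \<kappa>" "\<kappa> < 1 / 2" using \<epsilon> by (auto simp: \<kappa>_def)
  have n: "n \<ge> 1" using card by (simp add: n_def)
  have p0: "p > 0" using \<epsilon> \<kappa> by (simp add: p_def)
  have p4: "p \<le> 4 * \<epsilon>" using \<epsilon> \<kappa> by (simp add: p_def field_simps)
  have pk: "p * (1 - \<kappa>) = 2 * \<epsilon>" using \<kappa> by (simp add: p_def)
  \<comment> \<open>Here 2 \<epsilon> \<le> 1 - 2 \<kappa> \<le> (1 - \<kappa>)^2. The bound makes
    the weights nonnegative and later controls ln (1 - p).\<close>
  have p1: "1 - p \<ge> \<kappa>"
  proof -
    have "2 * \<epsilon> \<le> (1 - \<kappa>) * (1 - \<kappa>)"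
      using \<epsilon> \<kappa> sum_squares_ge_zero[of \<kappa> 0] by (simp add: \<kappa>_def algebra_simps)
    then show ?thesis using \<kappa> by (simp add: p_def field_simps)
  qed
  obtain z0 where z0: "z0 \<in> W" using card by fastforce
  have cardW: "real (card (W - {z0})) = n"
    using z0 finW card by (simp add: n_def)
  define w where "w = (\<lambda>z. if z = z0 then 1 - p else p / n)"
  have wsum: "(\<Sum>z\<in>S. w z) = real (card S) * (p / n)" if "S \<subseteq> W - {z0}" for S
    using that by (subst sum.cong[OF refl, of _ _ "\<lambda>_. p / n"]) (auto simp: w_def)
  have wW: "(\<Sum>z\<in>W. w z) = 1"
    using wsum[OF order_refl] sum.remove[OF finW z0, of w] cardW n by (simp add: w_def)
  have w0: "w z \<ge> 0" for z using p0 p1 \<kappa> n by (auto simp: w_def)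
  obtain D where D: "D \<in> distributions G" "\<And>S. S \<subseteq> W \<Longrightarrow> S \<in> sets D"
    "\<And>S. S \<subseteq> W \<Longrightarrow> measure D S = (\<Sum>z\<in>S. w z)"
    using distribution_of_weights[OF finW WZ ctx w0 wW] by blast
  have prob: "prob_space D" using D by (auto simp: distributions_def)
  define B where "B = {zs \<in> {..<m} \<rightarrow>\<^sub>E W. real (card {i\<in>{..<m}. zs i \<noteq> z0}) < \<kappa> * n}"
  have "measure (\<Pi>\<^sub>M i\<in>{..<m}. D) B \<le> 2 * \<delta>"
  proof (rule prob_large_unseen_mass_le[OF game H A W D(1,2) pac])
    show "B \<subseteq> {..<m} \<rightarrow>\<^sub>E W" by (auto simp: B_def)
    fix zs assume zs: "zs \<in> B"
    let ?I = "{i\<in>{..<m}. zs i \<noteq> z0}"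
    let ?U = "(W - {z0}) - zs ` ?I"
    have U: "?U \<subseteq> W - {z0}" "?U \<subseteq> W" by blast+
    \<comment> \<open>Each draw off \<open>z0\<close> reveals at most one light point.\<close>
    have "card (W - {z0}) \<le> card (?U \<union> zs ` ?I)"
      using finW by (intro card_mono) auto
    also have "\<dots> \<le> card ?U + card (zs ` ?I)" by (rule card_Un_le)
    also have "\<dots> \<le> card ?U + card ?I" by (simp add: card_image_le)
    finally have "n - \<kappa> * n < real (card ?U)" using cardW zs by (auto simp: B_def)
    then have "(n - \<kappa> * n) * (p / n) < real (card ?U) * (p / n)"
      using p0 n by (intro mult_strict_right_mono) auto
    also have "(n - \<kappa> * n) * (p / n) = 2 * \<epsilon>" unfolding pk[symmetric] using n by (simp add: field_simps)
    also have "real (card ?U) * (p / n) = measure D ?U"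
      by (simp only: D(3)[OF U(2)] wsum[OF U(1)])
    also have "\<dots> \<le> measure D (W - zs ` {..<m})"
      using prob_space.finite_measure[OF prob]
      by (intro finite_measure.finite_measure_mono D(2)) auto
    finally show "2 * \<epsilon> < measure D (W - zs ` {..<m})" .
  qed (use \<epsilon> in auto)
  moreover have "measure (\<Pi>\<^sub>M i\<in>{..<m}. D) B \<ge> 1 - real m * p / (\<kappa> * n)"
    "measure (\<Pi>\<^sub>M i\<in>{..<m}. D) B \<ge> (1 - p) ^ m"
    using prob_few_outside_ge[OF prob finW z0 D(2), of p "\<kappa> * n" m] D(3)[of W] D(3)[of "{z0}"]
      wW z0 \<kappa> n by (auto simp: w_def B_def)
  ultimately have le1: "1 - real m * p / (\<kappa> * n) \<le> 2 * \<delta>" and le2: "(1 - p) ^ m \<le> 2 * \<delta>"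
    by linarith+
  \<comment> \<open>Since \<delta> < \<epsilon> \<le> \<open>\<epsilon>\<^sub>0\<close>, the Markov
    bound forces \<open>m * p\<close> to be at least of order \<kappa>^2 n.\<close>
  have "2 * \<kappa> \<le> 1 - 2 * \<delta>" using \<epsilon> \<delta> by (simp add: \<kappa>_def)
  also have "\<dots> \<le> real m * p / (\<kappa> * n)" using le1 by simp
  finally have "2 * \<kappa> * (\<kappa> * n) \<le> real m * p"
    using \<kappa> n by (simp add: pos_le_divide_eq)
  also have "\<dots> \<le> real m * (4 * \<epsilon>)" using p4 by (intro mult_left_mono) auto
  finally have "\<kappa>\<^sup>2 * n \<le> 2 * (\<epsilon> * m)" by (simp add: power2_eq_square)
  moreover have "\<kappa>\<^sup>2 * card W \<le> \<kappa>\<^sup>2 * (2 * n)"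
    using card by (intro mult_left_mono) (auto simp: n_def)
  ultimately have bound1: "\<kappa>\<^sup>2 * card W \<le> 4 * (\<epsilon> * m)" by linarith
  define L where "L = ln (1 / (2 * \<delta>))"
  have L0: "L \<ge> 0" using \<epsilon> \<delta> by (simp add: L_def)
  \<comment> \<open>The inequality ln y \<le> y - 1 at y = 1 / (1 - p) makes -ln (1 - p) at most
    linear in \<epsilon>.\<close>
  have "ln (1 / (1 - p)) \<le> 1 / (1 - p) - 1"
    using p1 \<kappa> by (intro ln_le_minus_one) auto
  also have "\<dots> = p / (1 - p)" using p1 \<kappa> by (simp add: field_simps)
  also have "\<dots> \<le> 4 * \<epsilon> / \<kappa>"
    using p0 p1 p4 \<kappa> by (intro frac_le) auto
  finally have lnp: "- ln (1 - p) \<le> 4 * \<epsilon> / \<kappa>" using p1 \<kappa> by (simp add: ln_div)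
  have "ln ((1 - p) ^ m) \<le> ln (2 * \<delta>)" using le2 p1 \<kappa> \<delta> by (subst ln_le_cancel_iff) auto
  then have "L \<le> real m * - ln (1 - p)"
    using p1 \<kappa> \<delta> by (simp add: L_def ln_div ln_realpow)
  also have "\<dots> \<le> real m * (4 * \<epsilon> / \<kappa>)" using lnp by (intro mult_left_mono) auto
  finally have "\<kappa> * L \<le> 4 * (\<epsilon> * m)" using \<kappa> by (simp add: field_simps)
  moreover have "\<kappa>\<^sup>2 * L \<le> \<kappa> * L"
    using \<kappa> L0 by (intro mult_right_mono) (auto simp: power2_eq_square)
  ultimately have bound2: "\<kappa>\<^sup>2 * L \<le> 4 * (\<epsilon> * m)" by linarith
  \<comment> \<open>Passing from 1 / (2 \<delta>) to 1 / \<delta> costs ln 2 \<le> 1, absorbed by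
    the cardinality. The two bounds then add up to 2 * 4 + 4 = 12, rounded up to 16.\<close>
  have "ln (1 / \<delta>) = ln 2 + L" using \<delta> by (simp add: L_def ln_div ln_mult)
  also have "\<dots> \<le> card W + L" using card ln_le_minus_one[of 2] by simp
  finally have "\<kappa>\<^sup>2 * (card W + ln (1 / \<delta>)) \<le> \<kappa>\<^sup>2 * (2 * card W + L)"
    by (intro mult_left_mono) auto
  also have "\<dots> = 2 * (\<kappa>\<^sup>2 * card W) + \<kappa>\<^sup>2 * L" by (simp add: algebra_simps)
  also have "\<dots> \<le> 16 * (\<epsilon> * m)" using bound1 bound2 by (smt (verit) \<epsilon>(1) of_nat_0_le_iff mult_nonneg_nonneg)
  finally show ?thesis by (simp add: \<kappa>_def)
qed

section \<open>From sample sizes to sample complexity and dimension\<close>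

text \<open>The constant depends on \<open>\<epsilon>\<^sub>0\<close> alone. Dimension at least 2
  matters: if a single shattered point is the only context, one sample reveals the target, and no
  term ln (1 / \<delta>) / \<epsilon> can appear.\<close>

theorem theorem4p4:
  fixes \<epsilon>\<^sub>0 :: real
  assumes "\<epsilon>\<^sub>0 < 1 / 2"
  shows "\<exists>c::real. c > 0 \<and>
    (\<forall>(G :: ('a, 'b) game) (H :: (point \<Rightarrow> nat) set) (A :: 'a learner)
       (\<epsilon>::real) (\<delta>::real) (\<gamma>::real).
       stackelberg_game G \<longrightarrow>
       H \<subseteq> contexts G \<rightarrow>\<^sub>E types G \<longrightarrow>
       learning_algorithm G A \<longrightarrow>
       0 < \<epsilon> \<longrightarrow> \<epsilon> \<le> \<epsilon>\<^sub>0 \<longrightarrow> 0 < \<delta> \<longrightarrow> \<delta> < \<epsilon> \<longrightarrow> 0 < \<gamma> \<longrightarrow> \<gamma> < 1 \<longrightarrow>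
       2 \<le> SNdim G H \<gamma> \<longrightarrow>
       ereal_of_enat (sample_complexity G H A \<epsilon> \<delta> \<gamma>)
         \<ge> ereal c * ((ereal_of_enat (SNdim G H \<gamma>) + ereal (ln (1 / \<delta>))) / ereal \<epsilon>))"
proof -
  define c where "c = (1 / 2 - \<epsilon>\<^sub>0)\<^sup>2 / 16"
  have c: "c > 0" using assms by (simp add: c_def)
  show ?thesis
  proof (intro exI[of _ c] conjI c allI impI)
    fix G :: "('a, 'b) game" and H :: "(point \<Rightarrow> nat) set" and A :: "'a learner" and \<epsilon> \<delta> \<gamma> :: real
    assume game: "stackelberg_game G" and H: "H \<subseteq> contexts G \<rightarrow>\<^sub>E types G"
      and A: "learning_algorithm G A" and \<epsilon>: "0 < \<epsilon>" "\<epsilon> \<le> \<epsilon>\<^sub>0" and \<delta>: "0 < \<delta>" "\<delta> < \<epsilon>"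
      and dim: "2 \<le> SNdim G H \<gamma>"
    let ?s = "sample_complexity G H A \<epsilon> \<delta> \<gamma>" and ?d = "SNdim G H \<gamma>"
    show "ereal c * ((ereal_of_enat ?d + ereal (ln (1 / \<delta>))) / ereal \<epsilon>) \<le> ereal_of_enat ?s"
    proof (cases "?s")
      case (enat M)
      let ?Ms = "{M. \<forall>m\<ge>M. pac_at G H A \<epsilon> \<delta> \<gamma> m}"
      \<comment> \<open>A finite infimum in \<open>enat\<close> comes from a nonempty set and is
        attained, so \<open>M\<close> is itself a good sample size.\<close>
      have "enat ` ?Ms \<noteq> {}"
        using enat by (auto simp: sample_complexity_def Inf_enat_def split: if_splits)
      then have "?s \<in> enat ` ?Ms"
        unfolding sample_complexity_def by (metis (lifting) LeastI_ex Inf_enat_def ex_in_conv)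
      then have pac: "pac_at G H A \<epsilon> \<delta> \<gamma> M" using enat by auto
      have bound: "c * (card W + ln (1 / \<delta>)) \<le> \<epsilon> * M"
        if "SN_shattered G H \<gamma> W" "card W \<ge> 2" for W
        unfolding c_def
        using pac_at_lower_bound[OF game H A that pac \<epsilon> assms \<delta>] .
      \<comment> \<open>A finite sample complexity caps the size of every shattered set, so the
        dimension is finite too.\<close>
      define K where "K = nat \<lceil>\<epsilon> * M / c\<rceil>"
      have ln0: "ln (1 / \<delta>) \<ge> 0" using \<epsilon> \<delta> assms by simp
      have "card W \<le> max 2 K" if W: "SN_shattered G H \<gamma> W" for W
      proof (cases "card W \<ge> 2")
        case True
        have "real (card W) \<le> \<epsilon> * M / c - ln (1 / \<delta>)"
          using bound[OF W True] c by (simp add: field_simps)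
        then have "real (card W) \<le> \<epsilon> * M / c" using ln0 by simp
        then show ?thesis unfolding K_def by linarith
      qed auto
      then have "?d \<le> enat (max 2 K)"
        unfolding SNdim_def by (intro SUP_least) auto
      then obtain n where n: "?d = enat n"
        by (cases ?d) auto
      let ?Ws = "{W. SN_shattered G H \<gamma> W}"
      \<comment> \<open>A finite supremum of cardinalities is reached: some shattered set has more
        than \<open>n - 1\<close> points.\<close>
      have "enat (n - 1) < (SUP W\<in>?Ws. enat (card W))"
        using n dim by (simp add: SNdim_def[symmetric] numeral_eq_enat)
      then obtain W where W: "SN_shattered G H \<gamma> W" "n - 1 < card W"
        unfolding less_SUP_iff by auto
      have "n \<ge> 2" using dim n by (simp add: numeral_eq_enat)
      moreover from W this have "card W \<ge> n" by simp
      ultimately have "c * (n + ln (1 / \<delta>)) \<le> \<epsilon> * M"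
        using bound[OF W(1)] c
        by (smt (verit) mult_left_mono of_nat_mono le_trans)
      then have "c * ((n + ln (1 / \<delta>)) / \<epsilon>) \<le> M"
        using \<epsilon> by (simp add: field_simps)
      then show ?thesis
        using \<epsilon> by (simp add: n enat)
    qed auto
  qed
qed

end
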